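(* There is no linear space $X$ of measurable functions on the dyadic half-line $\mathbb{R}_+$ that has all of the following properties: (i) $\chi_{[0,1)} \in X$; (ii) $X$ is invariant with respect to the Walsh--Fourier transform, i.e. $\widehat f \in X$ for every $f \in X$; (iii) $X$ is invariant with respect to multiplication by linear functions, i.e. for every $f \in X$ and every linear function $\ell(x) = ax+b$, the function $x \mapsto \ell(x) f(x)$ belongs to $X$; (iv) every element $g \in L_2(\mathbb{R}_+)$ acts on $X$ by the formula of the inner product, i.e. the integral $\int_{\mathbb{R}_+} f g \, dx$ is defined (as a finite Lebesgue integral) for every $f \in X$ and every $g \in L_2(\mathbb{R}_+)$.
   Context: $\mathbb{R}_+ = [0,\infty)$. Each $x \in \mathbb{R}_+$ is written in binary form $x = \sum_{k \in \mathbb{Z}} x_k 2^k$, $x_k \in \{0,1\}$, with $x_k = 0$ for all sufficiently large $k$ (for dyadic rationals the finite expansion is used). The dyadic half-line is $\mathbb{R}_+$ equipped with the dyadic addition $x \oplus y = \sum_{k} 2^k (x_k + y_k)_2$, where $(x_k+y_k)_2$ is the sum modulo $2$, and with the usual Lebesgue measure; the spaces $L_p(\mathbb{R}_+)$ are the usual ones. $\chi_A$ denotes the indicator function of a set $A$. For $x, y \in \mathbb{R}_+$ put $(y,x) = \sum_{k \in \mathbb{Z}} y_k x_{-1-k}$ (a sum with finitely many nonzero terms). For an integer $k \ge 0$ the Walsh function is $\mathbf{w}_k(x) = (-1)^{(k,x)}$, and the generalized Walsh function is $\psi(x,y) = \mathbf{w}_{[y]}(x)\, \mathbf{w}_{[x]}(y)$,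 where $[\cdot]$ is the integer part. The Walsh--Fourier transform of $f \in L_1(\mathbb{R}_+)$ is $\widehat f(y) = \int_{\mathbb{R}_+} \psi(x,y) f(x)\, dx$; it extends in the usual way (by continuity from $L_1 \cap L_2$) to $L_2(\mathbb{R}_+)$, where it is an invertible orthogonal transform. *)

theory Defs
  imports "HOL-Analysis.Analysis"
begin

text \<open>
  \<open>binary_digit x k\<close> is the coefficient \<open>x\<^sub>k\<close> of \<open>2\<^sup>k\<close> in the binary expansion of \<open>x \<ge> 0\<close>; the lemmas
  below show that these are the digits of an expansion of \<open>x\<close>, finite when \<open>x\<close> is a dyadic rational.
\<close>

definition binary_digit :: "real \<Rightarrow> int \<Rightarrow> nat" where
  "binary_digit x k = nat (\<lfloor>x / 2 powi k\<rfloor> mod 2)"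

lemma binary_digit_le_1: "binary_digit x k \<le> 1"
  unfolding binary_digit_def by linarith

lemma binary_digit_eq_0_large:
  assumes "0 \<le> x" "x < 2 powi k"
  shows "binary_digit x k = 0"
proof -
  have "\<lfloor>x / 2 powi k\<rfloor> = 0"
    using assms by (simp add: floor_eq_iff)
  then show ?thesis by (simp add: binary_digit_def)
qed

lemma eventually_binary_digit_eq_0:
  assumes "0 \<le> x"
  obtains K where "\<And>k. k \<ge> K \<Longrightarrow> binary_digit x k = 0"
proof -
  obtain n where n: "x < 2 ^ n"
    using real_arch_pow[of 2 x] by auto
  show ?thesis
  proof (rule that)
    fix k assume "k \<ge> int n"
    then have "(2::real) powi int n \<le> 2 powi k"
      by (intro power_int_increasing) auto
    with n have "x < 2 powi k" by simp
    with assms show "binary_digit x k = 0" by (rule binary_digit_eq_0_large)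
  qed
qed

lemma binary_digit_dyadic:
  assumes "x = of_int m * 2 powi j" "k < j"
  shows "binary_digit x k = 0"
proof -
  define i where "i = nat (j - k - 1)"
  have j: "j = k + 1 + int i"
    using assms(2) by (simp add: i_def)
  have "x / 2 powi k = of_int (2 * (m * 2 ^ i))"
    by (simp add: assms(1) j power_int_add)
  then have "\<lfloor>x / 2 powi k\<rfloor> = 2 * (m * 2 ^ i)"
    by (metis floor_of_int)
  then show ?thesis by (simp add: binary_digit_def)
qed

lemma sum_binary_digits:
  "(\<Sum>i<n. binary_digit x (m + int i) * 2 powi (m + int i)) =
     \<lfloor>x / 2 powi m\<rfloor> * 2 powi m - \<lfloor>x / 2 powi (m + int n)\<rfloor> * 2 powi (m + int n)"
proof (induction n)
  case (Suc n)
  define k where "k = m + int n"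
  have "\<lfloor>x / 2 powi k\<rfloor> div 2 = \<lfloor>x / 2 powi (k + 1)\<rfloor>"
    using floor_divide_real_eq_div[of 2 "x / 2 powi k"] by (simp add: power_int_add)
  then have "\<lfloor>x / 2 powi k\<rfloor> mod 2 = \<lfloor>x / 2 powi k\<rfloor> - 2 * \<lfloor>x / 2 powi (k + 1)\<rfloor>"
    by (metis minus_mult_div_eq_mod)
  moreover have "real (binary_digit x k) = of_int (\<lfloor>x / 2 powi k\<rfloor> mod 2)"
    by (simp add: binary_digit_def)
  ultimately have "real (binary_digit x k) = \<lfloor>x / 2 powi k\<rfloor> - 2 * \<lfloor>x / 2 powi (k + 1)\<rfloor>"
    by simp
  moreover have "(a - 2 * b) * 2 powi k = a * 2 powi k - b * 2 powi (k + 1)" for a b :: real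
    by (simp add: power_int_add algebra_simps)
  ultimately have "binary_digit x k * 2 powi k =
      \<lfloor>x / 2 powi k\<rfloor> * 2 powi k - \<lfloor>x / 2 powi (k + 1)\<rfloor> * 2 powi (k + 1)"
    by (simp only: of_int_diff of_int_mult of_int_numeral)
  with Suc.IH show ?case
    by (simp add: k_def add_ac)
qed simp

lemma binary_expansion:
  assumes "0 \<le> x"
  shows "(\<lambda>n. \<Sum>i<2*n. binary_digit x (int i - int n) * 2 powi (int i - int n)) \<longlonglongrightarrow> x"
proof -
  obtain N where N: "x < 2 ^ N"
    using real_arch_pow[of 2 x] by auto
  have eq: "(\<Sum>i<2*n. binary_digit x (int i - int n) * 2 powi (int i - int n)) = \<lfloor>x * 2 ^ n\<rfloor> / 2 ^ n"
    if "n \<ge> N" for n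
  proof -
    have "x < 2 ^ n"
      using N that by (meson order_less_le_trans power_increasing one_le_numeral)
    then have "\<lfloor>x / 2 ^ n\<rfloor> = 0"
      using assms by (simp add: floor_eq_iff)
    then show ?thesis
      using sum_binary_digits[of x "- int n" "2 * n"]
      by (simp add: power_int_minus field_simps)
  qed
  have "(\<lambda>n. \<lfloor>x * 2 ^ n\<rfloor> / 2 ^ n) \<longlonglongrightarrow> x"
  proof (rule tendsto_sandwich)
    show "\<forall>\<^sub>F n in sequentially. x - (1/2) ^ n \<le> \<lfloor>x * 2 ^ n\<rfloor> / 2 ^ n"
    proof (intro always_eventually allI)
      fix n
      have "x * 2 ^ n - 1 \<le> \<lfloor>x * 2 ^ n\<rfloor>" by linarith
      then have "(x * 2 ^ n - 1) / 2 ^ n \<le> \<lfloor>x * 2 ^ n\<rfloor> / 2 ^ n"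
        by (rule divide_right_mono) simp
      then show "x - (1/2) ^ n \<le> \<lfloor>x * 2 ^ n\<rfloor> / 2 ^ n"
        by (simp add: diff_divide_distrib power_one_over)
    qed
    show "\<forall>\<^sub>F n in sequentially. \<lfloor>x * 2 ^ n\<rfloor> / 2 ^ n \<le> x"
      by (intro always_eventually allI) (simp add: pos_divide_le_eq)
    show "(\<lambda>n. x - (1/2) ^ n) \<longlonglongrightarrow> x"
      by (auto intro!: tendsto_eq_intros LIMSEQ_power_zero)
  qed simp
  moreover have "\<forall>\<^sub>F n in sequentially. \<lfloor>x * 2 ^ n\<rfloor> / 2 ^ n =
      (\<Sum>i<2*n. binary_digit x (int i - int n) * 2 powi (int i - int n))"
    using eventually_ge_at_top[of N] by (rule eventually_mono) (simp only: eq)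
  ultimately show ?thesis
    by (rule Lim_transform_eventually)
qed

definition dyadic_pairing :: "real \<Rightarrow> real \<Rightarrow> nat" where
  "dyadic_pairing y x =
     (\<Sum>k | binary_digit y k * binary_digit x (-1 - k) \<noteq> 0. binary_digit y k * binary_digit x (-1 - k))"

lemma finite_dyadic_pairing_support:
  assumes "0 \<le> y" "0 \<le> x"
  shows "finite {k. binary_digit y k * binary_digit x (-1 - k) \<noteq> 0}"
proof -
  obtain K where K: "\<And>k. k \<ge> K \<Longrightarrow> binary_digit y k = 0"
    using eventually_binary_digit_eq_0 assms(1) by blast
  obtain L where L: "\<And>k. k \<ge> L \<Longrightarrow> binary_digit x k = 0"
    using eventually_binary_digit_eq_0 assms(2) by blast
  have "{k. binary_digit y k * binary_digit x (-1 - k) \<noteq> 0} \<subseteq> {-1 - L..K}"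
  proof clarsimp
    fix k assume *: "0 < binary_digit y k" "0 < binary_digit x (-1 - k)"
    then have "\<not> k \<ge> K" "\<not> -1 - k \<ge> L"
      using K[of k] L[of "-1 - k"] by auto
    then show "-1 - L \<le> k \<and> k \<le> K" by linarith
  qed
  then show ?thesis by (rule finite_subset) simp
qed

definition walsh :: "nat \<Rightarrow> real \<Rightarrow> real" where
  "walsh k x = (-1) ^ dyadic_pairing (real k) x"

definition walsh_kernel :: "real \<Rightarrow> real \<Rightarrow> real" where
  "walsh_kernel x y = walsh (nat \<lfloor>y\<rfloor>) x * walsh (nat \<lfloor>x\<rfloor>) y"

text \<open>
  Functions on \<open>\<real>\<^sub>+\<close> are represented by functions on \<^typ>\<open>real\<close> whose values on the negative
  half-line are irrelevant. The value type is any \<open>real_normed_field\<close> that is also a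
  \<open>euclidean_space\<close>, which covers both \<^typ>\<open>real\<close> and \<^typ>\<open>complex\<close>.
\<close>

abbreviation half_line :: "real measure" where
  "half_line \<equiv> lebesgue_on {0..}"

definition L2 :: "(real \<Rightarrow> 'a::{real_normed_field,euclidean_space}) set" where
  "L2 = {f \<in> borel_measurable half_line. integrable half_line (\<lambda>x. (norm (f x))\<^sup>2)}"

definition L2_tendsto ::
    "(nat \<Rightarrow> real \<Rightarrow> 'a::{real_normed_field,euclidean_space}) \<Rightarrow> (real \<Rightarrow> 'a) \<Rightarrow> bool" where
  "L2_tendsto u f \<longleftrightarrow>
     (\<lambda>n. \<integral>\<^sup>+ x. ennreal ((norm (u n x - f x))\<^sup>2) \<partial>half_line) \<longlonglongrightarrow> 0"

definition walsh_fourier ::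
    "(real \<Rightarrow> 'a::{real_normed_field,euclidean_space}) \<Rightarrow> real \<Rightarrow> 'a" where
  "walsh_fourier f y = (\<integral>x. walsh_kernel x y *\<^sub>R f x \<partial>half_line)"

text \<open>
  \<open>F\<close> is (a representative of) the transform of \<open>f\<close>: on \<open>L\<^sub>1\<close> it is given by the integral, and on
  \<open>L\<^sub>2\<close> by continuity from \<open>L\<^sub>1 \<inter> L\<^sub>2\<close>. The transform is determined up to a null set only, hence
  a relation.
\<close>

definition is_walsh_fourier ::
    "(real \<Rightarrow> 'a::{real_normed_field,euclidean_space}) \<Rightarrow> (real \<Rightarrow> 'a) \<Rightarrow> bool" where
  "is_walsh_fourier f F \<longleftrightarrow>
     (integrable half_line f \<and> F \<in> borel_measurable half_line \<and>
        (AE y in half_line. F y = walsh_fourier f y)) \<or>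
     (f \<in> L2 \<and> F \<in> L2 \<and>
        (\<exists>u. (\<forall>n. integrable half_line (u n) \<and> u n \<in> L2) \<and>
             L2_tendsto u f \<and> L2_tendsto (\<lambda>n. walsh_fourier (u n)) F))"

definition linear_space_of_measurable_functions ::
    "(real \<Rightarrow> 'a::{real_normed_field,euclidean_space}) set \<Rightarrow> bool" where
  "linear_space_of_measurable_functions X \<longleftrightarrow>
     X \<subseteq> borel_measurable half_line \<and>
     (\<lambda>x. 0) \<in> X \<and>
     (\<forall>f\<in>X. \<forall>g\<in>X. (\<lambda>x. f x + g x) \<in> X) \<and>
     (\<forall>c. \<forall>f\<in>X. (\<lambda>x. c * f x) \<in> X)"

text \<open>
  Elements of \<open>X\<close> are individual functions. A space of classes modulo null sets corresponds to the
  set of all representatives of its elements, for which requiring some or all representatives of a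
  transform to belong to \<open>X\<close> amounts to the same.
\<close>

definition walsh_fourier_invariant ::
    "(real \<Rightarrow> 'a::{real_normed_field,euclidean_space}) set \<Rightarrow> bool" where
  "walsh_fourier_invariant X \<longleftrightarrow> (\<forall>f\<in>X. \<exists>F\<in>X. is_walsh_fourier f F)"

end

theory Submission
  imports Defs
begin

text \<open>
  On \<open>[0,1)\<close> the binary expansion reads \<open>x = 1/2 - (\<Sum>k. 2\<^bsup>-k-2\<^esup> w(x))\<close> with \<open>w\<close> the Walsh function
  of index \<open>2\<^sup>k\<close>, because that function is \<open>1\<close> or \<open>-1\<close> according to the digit of \<open>x\<close> in place
  \<open>-1-k\<close>. The transform exchanges the restriction to \<open>[0,1)\<close> of the Walsh function of index \<open>m\<close>
  with the indicator of \<open>[m,m+1)\<close>. Hence the transform \<open>F\<close> of the ramp \<open>x \<chi>(x)\<close>, \<open>\<chi>\<close> the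
  indicator of \<open>[0,1)\<close>, has the value \<open>-2\<^bsup>-k-2\<^esup>\<close> on every interval \<open>[2\<^sup>k, 2\<^sup>k+1)\<close>, and multiplying by
  \<open>x\<close> once more gives a function of modulus at least \<open>1/4\<close> on infinitely many unit intervals. A space
  with the four properties would contain this function \<open>x F(x)\<close>, which is not in \<open>L\<^sub>2\<close> and therefore
  cannot be integrated against every element of \<open>L\<^sub>2\<close>.

  The transform is only given up to null sets, and on \<open>L\<^sub>2\<close> only as a limit. It is therefore never
  evaluated at a point; only its means over the intervals \<open>[m,m+1)\<close> are used. By Fubini such a mean is
  the integral of the original function against a Walsh function over \<open>[0,1)\<close>, and by Cauchy--Schwarz
  this survives limits in \<open>L\<^sub>2\<close> (lemma \<open>set_integral_is_walsh_fourier\<close>). For the ramp this leaves the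
  first moments of the Walsh functions of index \<open>2\<^sup>k\<close> (lemma \<open>has_integral_id_times_walsh_power2\<close>).
  Means suffice for the contradiction, because the test function in \<open>L\<^sub>2\<close> can be chosen to be a
  constant multiple of \<open>1/x\<close> on each of the intervals, so that its product with \<open>x F(x)\<close> is a constant
  multiple of \<open>F\<close> there (lemma \<open>L2_function_on_dyadic_units\<close>). The integrals of the product over the
  intervals are then of the size of the terms of the harmonic series.
\<close>

section \<open>Walsh functions under doubling and integer translation\<close>

text \<open>
  The digits of an integer vanish in the negative places, so only the digits of \<open>x\<close> after the binary
  point matter.
\<close>

lemma dyadic_pairing_nat:
  assumes "m < 2 ^ N"
  shows "dyadic_pairing (real m) x = (\<Sum>i<N. (m div 2 ^ i mod 2) * binary_digit x (- 1 - int i))"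
proof -
  have digit: "binary_digit (real m) (int i) = m div 2 ^ i mod 2" for i
  proof -
    have "\<lfloor>real m / 2 powi int i\<rfloor> = int (m div 2 ^ i)"
      using floor_divide_of_nat_eq[of m "2 ^ i"] by simp
    then show ?thesis by (simp add: binary_digit_def nat_mod_distrib)
  qed
  have neg: "binary_digit (real m) k = 0" if "k < 0" for k
    using binary_digit_dyadic[of "real m" "int m" 0 k] that by simp
  have large: "binary_digit (real m) k = 0" if "k \<ge> int N" for k
  proof (rule binary_digit_eq_0_large)
    have "real m < 2 powi int N" using assms by (simp flip: of_nat_less_iff)
    also have "(2::real) powi int N \<le> 2 powi k"
      using that by (intro power_int_increasing) auto
    finally show "real m < 2 powi k" .
  qed simp
  have "dyadic_pairing (real m) x = (\<Sum>k\<in>int ` {..<N}. binary_digit (real m) k * binary_digit x (-1 - k))"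
    unfolding dyadic_pairing_def
  proof (rule sum.mono_neutral_left)
    show "{k. binary_digit (real m) k * binary_digit x (- 1 - k) \<noteq> 0} \<subseteq> int ` {..<N}"
    proof
      fix k assume "k \<in> {k. binary_digit (real m) k * binary_digit x (- 1 - k) \<noteq> 0}"
      then have "binary_digit (real m) k \<noteq> 0" by simp
      then have "0 \<le> k" "k < int N" using neg[of k] large[of k] by linarith+
      then show "k \<in> int ` {..<N}" by (intro image_eqI[of _ _ "nat k"]) auto
    qed
  qed auto
  also have "\<dots> = (\<Sum>i<N. binary_digit (real m) (int i) * binary_digit x (- 1 - int i))"
    by (subst sum.reindex) auto
  finally show ?thesis by (simp add: digit)
qed

lemma walsh_0 [simp]: "walsh 0 x = 1"
  using dyadic_pairing_nat[of 0 0 x] by (simp add: walsh_def)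

lemma binary_digit_double: "binary_digit (2 * x) (k + 1) = binary_digit x k"
  by (simp add: binary_digit_def power_int_add)

text \<open>
  Doubling shifts the digits of \<open>x\<close> by one place, as appending a digit \<open>e\<close> does with those of \<open>m\<close>.
  All integrals of Walsh functions below come from this recursion.
\<close>

lemma walsh_double:
  assumes "e < 2"
  shows "walsh (2 * m + e) x = (-1) ^ (e * binary_digit (2 * x) 0) * walsh m (2 * x)"
proof -
  have less: "m < 2 ^ m" by (rule less_exp)
  then have less': "2 * m + e < 2 ^ Suc m" using assms unfolding power_Suc by linarith
  have d: "(2 * m + e) div 2 ^ Suc i = m div 2 ^ i" for i
    using assms by (simp add: div_mult2_eq)
  have b: "binary_digit x (- 2 - int i) = binary_digit (2 * x) (- 1 - int i)" for i
    using binary_digit_double[of x "- 2 - int i"] by (simp add: algebra_simps)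
  have "dyadic_pairing (real (2 * m + e)) x = e * binary_digit (2 * x) 0 + dyadic_pairing (real m) (2 * x)"
    unfolding dyadic_pairing_nat[OF less] dyadic_pairing_nat[OF less'] sum.lessThan_Suc_shift
    using assms binary_digit_double[of x "-1"]
    by (simp add: d b del: power_Suc)
  then show ?thesis by (simp add: walsh_def power_add)
qed

lemma binary_digit_add_1:
  assumes "k < 0"
  shows "binary_digit (x + 1) k = binary_digit x k"
proof -
  define j where "j = nat (- k - 1)"
  have k: "k = - int (Suc j)" using assms by (simp add: j_def)
  have "(x + 1) / 2 powi k = x / 2 powi k + of_int (2 * 2 ^ j)"
    unfolding k power_int_minus power_int_of_nat by (simp add: field_simps)
  then have "\<lfloor>(x + 1) / 2 powi k\<rfloor> = \<lfloor>x / 2 powi k\<rfloor> + 2 * 2 ^ j"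
    by (metis floor_add_int)
  then show ?thesis by (simp add: binary_digit_def)
qed

lemma walsh_add_1: "walsh m (x + 1) = walsh m x"
  using dyadic_pairing_nat[OF less_exp[of m]] by (simp add: walsh_def binary_digit_add_1)

lemma walsh_add_of_nat: "walsh m (x + real n) = walsh m x"
proof (induction n)
  case (Suc n)
  then show ?case using walsh_add_1[of m "x + real n"] by (simp add: add_ac)
qed simp

lemma abs_walsh [simp]: "\<bar>walsh m x\<bar> = 1"
  by (simp add: walsh_def power_abs)

text \<open>The exponent of \<open>-1\<close> is moved into a cosine, which is manifestly measurable.\<close>

lemma borel_measurable_walsh [measurable]: "walsh m \<in> borel_measurable borel"
proof -
  have [measurable]: "(\<lambda>x. real (binary_digit x k)) \<in> borel_measurable borel" for k
    unfolding binary_digit_def by measurable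
  have eq: "walsh m = (\<lambda>x. cos (real (\<Sum>i<m. (m div 2 ^ i mod 2) * binary_digit x (- 1 - int i)) * pi))"
    by (simp only: walsh_def dyadic_pairing_nat[OF less_exp[of m]] cos_npi fun_eq_iff simp_thms)
  show ?thesis
    unfolding eq of_nat_sum of_nat_mult by measurable
qed

section \<open>Integrals of Walsh functions over the unit interval\<close>

lemma has_integral_double_01:
  fixes h :: "real \<Rightarrow> real"
  assumes "(h has_integral a) {0..1}" "((\<lambda>x. h (x + 1)) has_integral b) {0..1}"
  shows "((\<lambda>x. h (2 * x)) has_integral (a + b) / 2) {0..1}"
proof -
  have "(h has_integral b) {1..2}"
    using has_integral_affinity'[OF assms(2)[folded cbox_interval], of 1 "-1"] by simp
  then have "(h has_integral a + b) {0..2}"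
    using has_integral_combine[of 0 1 2 h a b] assms(1) by simp
  from has_integral_affinity'[OF this[folded cbox_interval], of 2 0]
  show ?thesis by simp
qed

lemma binary_digit_0_unit: "0 \<le> x \<Longrightarrow> x < 1 \<Longrightarrow> binary_digit x 0 = 0"
  by (rule binary_digit_eq_0_large) auto

lemma binary_digit_0_unit_add_1: "0 \<le> x \<Longrightarrow> x < 1 \<Longrightarrow> binary_digit (x + 1) 0 = 1"
  by (simp add: binary_digit_def floor_eq_iff[of x 0, THEN iffD2])

text \<open>
  The recursion in integrated form. On the two unit intervals covered by \<open>2 * x\<close> the Walsh function of
  index \<open>m\<close> is the same, and the new factor is \<open>1\<close> on the first and \<open>(-1) ^ e\<close> on the second. The weight
  \<open>h\<close> is arbitrary so that both the mean values and the first moments are instances.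
\<close>

lemma has_integral_walsh_double:
  fixes h :: "real \<Rightarrow> real"
  assumes "e < 2"
    and a: "((\<lambda>x. h x * walsh m x) has_integral a) {0..1}"
    and b: "((\<lambda>x. h (x + 1) * walsh m x) has_integral b) {0..1}"
  shows "((\<lambda>x. h (2 * x) * walsh (2 * m + e) x) has_integral (a + (-1) ^ e * b) / 2) {0..1}"
proof -
  let ?g = "\<lambda>y. h y * ((-1) ^ (e * binary_digit y 0) * walsh m y)"
  have "(?g has_integral a) {0..1}"
    by (rule has_integral_spike_finite[OF _ _ a, of "{1}"]) (auto simp: binary_digit_0_unit)
  moreover have "((\<lambda>x. ?g (x + 1)) has_integral (-1) ^ e * b) {0..1}"
    by (rule has_integral_spike_finite[OF _ _ has_integral_mult_right[OF b], of "{1}"])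
       (auto simp: binary_digit_0_unit_add_1 walsh_add_1)
  ultimately show ?thesis
    using has_integral_double_01[of ?g] assms(1) by (simp add: walsh_double)
qed

text \<open>
  If the last digit of \<open>m\<close> is \<open>1\<close>, the two halves of the interval cancel; otherwise the integral is
  that for \<open>m div 2\<close>.
\<close>

lemma has_integral_walsh: "(walsh m has_integral (if m = 0 then 1 else 0)) {0..1}"
proof (induction m rule: less_induct)
  case (less m)
  show ?case
  proof (cases "m = 0")
    case True
    have "walsh 0 = (\<lambda>x. 1)" by (rule ext) simp
    then show ?thesis using True has_integral_const_real[of "1::real" 0 1] by simp
  next
    case False
    define c :: real where "c = (if m div 2 = 0 then 1 else 0)"
    have "(walsh (m div 2) has_integral c) {0..1}"
      using less.IH[of "m div 2"] False by (simp add: c_def)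
    then have "(walsh m has_integral (c + (- 1) ^ (m mod 2) * c) / 2) {0..1}"
      using has_integral_walsh_double[of "m mod 2" "\<lambda>_. 1" "m div 2" c c] by simp
    moreover have "c + (- 1) ^ (m mod 2) * c = 0"
    proof (cases "m div 2 = 0")
      case True
      then have "m mod 2 = 1" using False by presburger
      then show ?thesis by simp
    qed (simp add: c_def)
    ultimately show ?thesis using False by simp
  qed
qed

text \<open>
  These are the coefficients \<open>-2\<^bsup>-k-2\<^esup>\<close> in the Walsh expansion of \<open>x\<close>. Passing from \<open>k\<close> to \<open>k + 1\<close>
  halves the moment: both halves of the interval contribute the same, since the translation of \<open>x\<close>
  by \<open>1\<close> only adds a multiple of the vanishing mean value.
\<close>

lemma has_integral_id_times_walsh_power2:
  "((\<lambda>x. x * walsh (2 ^ k) x) has_integral - (1 / 2 ^ (k + 2))) {0..1}"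
proof (induction k)
  case 0
  have 1: "((\<lambda>x::real. x / 2) has_integral 1 / 4) {0..1}"
    using has_integral_divide[OF ident_has_integral[of 0 1], of 2] by simp
  have "((\<lambda>x::real. x / 2 + 1 / 2) has_integral 1 / 4 + 1 / 2) {0..1}"
    using has_integral_add[OF 1 has_integral_const_real[of "1/2::real" 0 1]] by simp
  then have 2: "((\<lambda>x::real. (x + 1) / 2) has_integral 3 / 4) {0..1}"
    by (simp add: add_divide_distrib)
  show ?case
    using has_integral_walsh_double[of 1 "\<lambda>x. x / 2" 0 "1 / 4" "3 / 4"] 1 2 by simp
next
  case (Suc k)
  have w: "(walsh (2 ^ k) has_integral 0) {0..1}"
    using has_integral_walsh[of "2 ^ k"] by simp
  have 1: "((\<lambda>x. x / 2 * walsh (2 ^ k) x) has_integral - (1 / 2 ^ (k + 3))) {0..1}"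
    using has_integral_divide[OF Suc.IH, of 2] by (simp add: power_add mult.commute)
  have 2: "((\<lambda>x. (x + 1) / 2 * walsh (2 ^ k) x) has_integral - (1 / 2 ^ (k + 3))) {0..1}"
    using has_integral_add[OF 1 has_integral_divide[OF w, of 2]] by (simp add: field_simps)
  show ?case
    using has_integral_walsh_double[of 0 "\<lambda>x. x / 2" "2 ^ k", OF _ 1 2] by (simp add: power_add mult.commute)
qed

section \<open>Lebesgue integrals on the half-line\<close>

lemma borel_measurable_half_lineI:
  "f \<in> borel_measurable borel \<Longrightarrow> f \<in> borel_measurable half_line"
  by (intro measurable_restrict_space1 measurable_completion) simp

lemma atLeastLessThan_sets_half_line:
  fixes a b :: real
  assumes "0 \<le> a"
  shows "{a..<b} \<in> sets half_line"
  using assms by (auto simp: sets_restrict_space_iff)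

lemma emeasure_half_line_atLeastLessThan:
  fixes a b :: real
  assumes "0 \<le> a" "a \<le> b"
  shows "emeasure half_line {a..<b} = ennreal (b - a)"
  using assms by (subst emeasure_restrict_space) auto

lemma sigma_finite_half_line: "sigma_finite_measure half_line"
proof -
  obtain A :: "real set set" where A: "countable A" "A \<subseteq> sets lborel" "\<Union>A = space lborel"
      "\<forall>a\<in>A. emeasure lborel a \<noteq> \<infinity>"
    using lborel.sigma_finite_countable by blast
  have "sigma_finite_measure (lebesgue :: real measure)"
  proof
    show "\<exists>A :: real set set. countable A \<and> A \<subseteq> sets lebesgue \<and> \<Union>A = space lebesgue \<and>
        (\<forall>a\<in>A. emeasure lebesgue a \<noteq> \<infinity>)"
      using A by (intro exI[of _ A]) auto
  qed
  then show ?thesis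
    by (rule sigma_finite_measure_restrict_space) simp
qed

lemma set_integral_half_line_eqI:
  fixes f :: "real \<Rightarrow> real"
  assumes f [measurable]: "f \<in> borel_measurable borel"
    and bound: "\<And>x. x \<in> {a..b} \<Longrightarrow> \<bar>f x\<bar> \<le> B"
    and int: "(f has_integral c) {a..b}"
    and "0 \<le> a"
  shows "set_integrable half_line {a..<b} f" "(LINT x:{a..<b}|half_line. f x) = c"
proof -
  have leb: "set_integrable lebesgue {a..<b} f"
    unfolding set_integrable_def
  proof (rule integrableI_bounded_set_indicator)
    show "f \<in> borel_measurable lebesgue" by (intro measurable_completion) simp
    show "emeasure lebesgue {a..<b} < \<infinity>"
      by (cases "a \<le> b") auto
    show "AE x in lebesgue. x \<in> {a..<b} \<longrightarrow> norm (f x) \<le> B" using bound by auto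
  qed simp
  (* The interval lies in the half-line, so the restriction of the measure is invisible. *)
  have restrict: "(\<lambda>x. indicator {0..} x *\<^sub>R indicator {a..<b} x *\<^sub>R f x) = (\<lambda>x. indicator {a..<b} x *\<^sub>R f x)"
    using assms(4) by (auto simp: indicator_def fun_eq_iff)
  show "set_integrable half_line {a..<b} f"
    using leb unfolding set_integrable_def by (subst integrable_restrict_space) (simp_all only: restrict, simp)
  have "(LINT x:{a..<b}|half_line. f x) = (LINT x:{a..<b}|lebesgue. f x)"
    unfolding set_lebesgue_integral_def by (subst integral_restrict_space) (simp_all only: restrict, simp)
  moreover have "(f has_integral (LINT x:{a..<b}|lebesgue. f x)) {a..<b}"
    by (rule has_integral_set_lebesgue[OF leb])
  then have "(f has_integral (LINT x:{a..<b}|lebesgue. f x)) {a..b}"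
    by (rule has_integral_spike_set_eq[THEN iffD1, rotated -1])
       (auto intro!: negligible_subset[OF negligible_finite[of "{b}"]])
  ultimately show "(LINT x:{a..<b}|half_line. f x) = c"
    using int has_integral_unique by metis
qed

section \<open>Means of a transform over unit intervals\<close>

lemma set_integral_walsh:
  "(LINT y:{real m..<real m + 1}|half_line. walsh n y) = (if n = 0 then 1 else 0)"
proof (rule set_integral_half_line_eqI(2)[where B = 1])
  have "walsh n (x - real m) = walsh n x" for x
    using walsh_add_of_nat[of n "x - real m" m] by simp
  then show "(walsh n has_integral (if n = 0 then 1 else 0)) {real m..real m + 1}"
    using has_integral_affinity'[OF has_integral_walsh[of n, folded cbox_interval], of 1 "- real m"]
    by (simp add: add.commute)
qed auto

text \<open>In each factor of the kernel the index takes countably many values.\<close>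

lemma walsh_kernel_measurable [measurable]:
  "(\<lambda>(x, y). walsh_kernel x y) \<in> borel_measurable (half_line \<Otimes>\<^sub>M half_line)"
proof -
  have id [measurable]: "(\<lambda>x. x) \<in> measurable half_line borel"
    by (rule borel_measurable_half_lineI) simp
  have [measurable]: "fst \<in> measurable (half_line \<Otimes>\<^sub>M half_line) (borel :: real measure)"
      "snd \<in> measurable (half_line \<Otimes>\<^sub>M half_line) (borel :: real measure)"
    using measurable_compose[OF measurable_fst id] measurable_compose[OF measurable_snd id] by simp_all
  have "(\<lambda>p. walsh (nat \<lfloor>snd p\<rfloor>) (fst p)) \<in> borel_measurable (half_line \<Otimes>\<^sub>M half_line)"
    by (rule measurable_compose_countable[where g = "\<lambda>p. nat \<lfloor>snd p\<rfloor>"]) measurable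
  moreover have "(\<lambda>p. walsh (nat \<lfloor>fst p\<rfloor>) (snd p)) \<in> borel_measurable (half_line \<Otimes>\<^sub>M half_line)"
    by (rule measurable_compose_countable[where g = "\<lambda>p. nat \<lfloor>fst p\<rfloor>"]) measurable
  ultimately show ?thesis
    unfolding walsh_kernel_def case_prod_unfold by measurable
qed

lemma abs_walsh_kernel [simp]: "\<bar>walsh_kernel x y\<bar> = 1"
  by (simp add: walsh_kernel_def abs_mult)

text \<open>
  The transform of the indicator of \<open>[m,m+1)\<close>: for \<open>y\<close> in this interval the first factor of the kernel
  is the Walsh function of index \<open>m\<close> at \<open>x\<close>, and the second has mean \<open>0\<close> unless its index \<open>\<lfloor>x\<rfloor>\<close>
  is \<open>0\<close>.
\<close>

lemma set_integral_walsh_kernel: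
  assumes "0 \<le> x"
  shows "(LINT y:{real m..<real m + 1}|half_line. walsh_kernel x y) = indicator {0..<1} x * walsh m x"
proof -
  have "(LINT y:{real m..<real m + 1}|half_line. walsh_kernel x y) =
      (LINT y:{real m..<real m + 1}|half_line. walsh m x * walsh (nat \<lfloor>x\<rfloor>) y)"
  proof (rule set_lebesgue_integral_cong)
    show "\<forall>y. y \<in> {real m..<real m + 1} \<longrightarrow> walsh_kernel x y = walsh m x * walsh (nat \<lfloor>x\<rfloor>) y"
    proof safe
      fix y assume "y \<in> {real m..<real m + 1}"
      then have "\<lfloor>y\<rfloor> = int m" by (simp add: floor_eq_iff)
      then show "walsh_kernel x y = walsh m x * walsh (nat \<lfloor>x\<rfloor>) y"
        by (simp add: walsh_kernel_def)
    qed
  qed (simp add: atLeastLessThan_sets_half_line)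
  also have "\<dots> = walsh m x * (if nat \<lfloor>x\<rfloor> = 0 then 1 else 0)"
    using set_integral_walsh by simp
  also have "(nat \<lfloor>x\<rfloor> = 0) \<longleftrightarrow> x \<in> {0..<1}"
    using assms by (auto simp: floor_eq_iff)
  finally show ?thesis by (auto simp: indicator_def)
qed

text \<open>
  Fubini, applied to \<open>walsh_kernel x y *\<^sub>R u x\<close> on the strip where \<open>y\<close> is in \<open>[m,m+1)\<close>. The kernel has
  modulus \<open>1\<close> and the strip has width \<open>1\<close>, so the \<open>L\<^sub>1\<close> norm on the strip is that of \<open>u\<close>.
\<close>

lemma set_integral_walsh_fourier:
  fixes u :: "real \<Rightarrow> 'a::{real_normed_field,euclidean_space}"
  assumes u: "integrable half_line u"
  shows "set_integrable half_line {real m..<real m + 1} (walsh_fourier u)"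
    and "(LINT y:{real m..<real m + 1}|half_line. walsh_fourier u y) =
      (LINT x:{0..<1}|half_line. walsh m x *\<^sub>R u x)"
proof -
  interpret half_line: sigma_finite_measure half_line by (rule sigma_finite_half_line)
  interpret P: pair_sigma_finite half_line half_line ..
  let ?I = "{real m..<real m + 1}"
  let ?f = "\<lambda>(x, y). (indicator ?I y * walsh_kernel x y) *\<^sub>R u x"
  have I [measurable]: "?I \<in> sets half_line" by (simp add: atLeastLessThan_sets_half_line)
  have fin: "integrable half_line (indicator ?I :: real \<Rightarrow> real)"
    by (rule integrable_real_indicator) (simp_all add: emeasure_half_line_atLeastLessThan)
  have [measurable]: "u \<in> borel_measurable half_line" using u by simp
  have meas [measurable]: "?f \<in> borel_measurable (half_line \<Otimes>\<^sub>M half_line)"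
    using walsh_kernel_measurable by (simp add: case_prod_unfold)
  have kernel: "integrable half_line (\<lambda>y. indicator ?I y * walsh_kernel x y)" if "x \<in> space half_line" for x
  proof (rule Bochner_Integration.integrable_bound[OF fin])
    have "walsh_kernel x \<in> borel_measurable half_line"
      using measurable_Pair2[OF walsh_kernel_measurable that] by simp
    then show "(\<lambda>y. indicator ?I y * walsh_kernel x y) \<in> borel_measurable half_line" by measurable
  qed (simp add: abs_mult)
  have int: "integrable (half_line \<Otimes>\<^sub>M half_line) ?f"
  proof (rule P.Fubini_integrable)
    have half: "?I \<inter> {0..} = ?I" by auto
    have eq: "(\<integral>y. norm (?f (x, y)) \<partial>half_line) = norm (u x)" for x
      using emeasure_half_line_atLeastLessThan[of "real m" "real m + 1"] half
      by (simp add: abs_mult measure_def)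
    show "integrable half_line (\<lambda>x. \<integral>y. norm (?f (x, y)) \<partial>half_line)"
      unfolding eq by (rule integrable_norm[OF u])
    have "integrable half_line (\<lambda>y. ?f (x, y))" if "x \<in> space half_line" for x
      using kernel[OF that] by simp
    then show "AE x in half_line. integrable half_line (\<lambda>y. ?f (x, y))" by (rule AE_I2)
  qed fact
  have inner: "(\<integral>x. ?f (x, y) \<partial>half_line) = indicator ?I y *\<^sub>R walsh_fourier u y" for y
    by (simp add: walsh_fourier_def flip: scaleR_scaleR)
  have outer: "(\<integral>y. ?f (x, y) \<partial>half_line) = indicator {0..<1} x *\<^sub>R walsh m x *\<^sub>R u x"
    if "x \<in> space half_line" for x
    using set_integral_walsh_kernel[of x m] that kernel[OF that]
    by (simp add: set_lebesgue_integral_def)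
  show "set_integrable half_line ?I (walsh_fourier u)"
    using P.integrable_snd[of "\<lambda>x y. ?f (x, y)"] int unfolding set_integrable_def inner by simp
  have "(LINT y:?I|half_line. walsh_fourier u y) = (\<integral>y. (\<integral>x. ?f (x, y) \<partial>half_line) \<partial>half_line)"
    unfolding inner set_lebesgue_integral_def ..
  also have "\<dots> = (\<integral>x. (\<integral>y. ?f (x, y) \<partial>half_line) \<partial>half_line)"
    using P.Fubini_integral[of "\<lambda>x y. ?f (x, y)"] int by simp
  also have "\<dots> = (LINT x:{0..<1}|half_line. walsh m x *\<^sub>R u x)"
    unfolding set_lebesgue_integral_def by (rule Bochner_Integration.integral_cong[OF refl outer])
  finally show "(LINT y:?I|half_line. walsh_fourier u y) = (LINT x:{0..<1}|half_line. walsh m x *\<^sub>R u x)" .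
qed

text \<open>Cauchy--Schwarz against the indicator of a set of measure \<open>1\<close>.\<close>

lemma norm_set_integral_square_le:
  fixes f :: "'b \<Rightarrow> 'a::{banach, second_countable_topology}"
  assumes [measurable]: "f \<in> borel_measurable M" "A \<in> sets M"
    and A: "emeasure M A = 1" and f: "set_integrable M A f"
  shows "ennreal ((norm (LINT x:A|M. f x))\<^sup>2) \<le> (\<integral>\<^sup>+ x. ennreal ((norm (f x))\<^sup>2) \<partial>M)"
proof -
  have "ennreal (norm (LINT x:A|M. f x)) \<le> (\<integral>\<^sup>+ x. ennreal (norm (indicator A x *\<^sub>R f x)) \<partial>M)"
    using f unfolding set_lebesgue_integral_def set_integrable_def
    by (rule integral_norm_bound_ennreal)
  also have "\<dots> = (\<integral>\<^sup>+ x. indicator A x * ennreal (norm (f x)) \<partial>M)"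
    by (intro nn_integral_cong) (simp add: indicator_def)
  finally have "(ennreal (norm (LINT x:A|M. f x)))\<^sup>2 \<le> (\<integral>\<^sup>+ x. indicator A x * ennreal (norm (f x)) \<partial>M)\<^sup>2"
    by (rule power_mono) simp
  also have "\<dots> \<le> (\<integral>\<^sup>+ x. (indicator A x)\<^sup>2 \<partial>M) * (\<integral>\<^sup>+ x. (ennreal (norm (f x)))\<^sup>2 \<partial>M)"
    by (rule Cauchy_Schwarz_nn_integral) measurable
  also have "(\<integral>\<^sup>+ x. (indicator A x)\<^sup>2 \<partial>M) = (\<integral>\<^sup>+ x. indicator A x \<partial>M)"
    by (intro nn_integral_cong) (simp add: indicator_def)
  also have "\<dots> = 1" using A by simp
  finally show ?thesis by (simp add: ennreal_power)
qed

lemma set_integrable_L2: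
  fixes f :: "real \<Rightarrow> 'a::{real_normed_field,euclidean_space}"
  assumes f: "f \<in> L2" and [measurable]: "A \<in> sets half_line" and A: "emeasure half_line A < \<infinity>"
  shows "set_integrable half_line A f"
  unfolding set_integrable_def
proof (rule Bochner_Integration.integrable_bound)
  show "integrable half_line (\<lambda>x. indicator A x + (norm (f x))\<^sup>2)"
    using f A by (intro Bochner_Integration.integrable_add integrable_real_indicator) (auto simp: L2_def)
  show "(\<lambda>x. indicator A x *\<^sub>R f x) \<in> borel_measurable half_line"
    using f unfolding L2_def by (intro borel_measurable_scaleR borel_measurable_indicator) auto
  have "norm z \<le> 1 + (norm z)\<^sup>2" for z :: 'a
    using zero_le_power2[of "norm z - 1/2"] by (simp add: power2_diff field_simps)
  then show "AE x in half_line. norm (indicator A x *\<^sub>R f x) \<le> norm (indicator A x + (norm (f x))\<^sup>2)"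
    by (auto simp: indicator_def)
qed

lemma L2_tendsto_set_integral:
  fixes u :: "nat \<Rightarrow> real \<Rightarrow> 'a::{real_normed_field,euclidean_space}"
  assumes lim: "L2_tendsto u f"
    and [measurable]: "\<And>n. u n \<in> borel_measurable half_line" "f \<in> borel_measurable half_line" "A \<in> sets half_line"
    and A: "emeasure half_line A = 1"
    and int: "\<And>n. set_integrable half_line A (u n)" "set_integrable half_line A f"
  shows "(\<lambda>n. LINT x:A|half_line. u n x) \<longlonglongrightarrow> (LINT x:A|half_line. f x)"
proof -
  define d where "d n = (LINT x:A|half_line. u n x) - (LINT x:A|half_line. f x)" for n
  have le: "ennreal ((norm (d n))\<^sup>2) \<le> (\<integral>\<^sup>+ x. ennreal ((norm (u n x - f x))\<^sup>2) \<partial>half_line)" for n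
    unfolding d_def set_integral_diff(2)[OF int, symmetric]
    using set_integral_diff(1)[OF int] A by (intro norm_set_integral_square_le) simp_all
  have "(\<lambda>n. ennreal ((norm (d n))\<^sup>2)) \<longlonglongrightarrow> ennreal 0"
  proof (rule tendsto_sandwich[OF _ _ tendsto_const])
    show "(\<lambda>n. \<integral>\<^sup>+ x. ennreal ((norm (u n x - f x))\<^sup>2) \<partial>half_line) \<longlonglongrightarrow> ennreal 0"
      using lim by (simp only: L2_tendsto_def ennreal_0)
  qed (simp_all add: le)
  then have "(\<lambda>n. (norm (d n))\<^sup>2) \<longlonglongrightarrow> 0"
    by (subst (asm) tendsto_ennreal_iff) auto
  then have "d \<longlonglongrightarrow> 0"
    by (simp add: tendsto_norm_zero_iff)
  then show ?thesis
    unfolding d_def by (rule LIM_zero_cancel)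
qed

text \<open>
  This is all that is used about the transform, and it holds for every representative. On \<open>L\<^sub>1\<close> it is
  the Fubini identity; on \<open>L\<^sub>2\<close> both sides of that identity for the approximating functions converge,
  because multiplication by a Walsh function is isometric.
\<close>

lemma set_integral_is_walsh_fourier:
  fixes f F :: "real \<Rightarrow> 'a::{real_normed_field,euclidean_space}"
  assumes "is_walsh_fourier f F"
  shows "(LINT y:{real m..<real m + 1}|half_line. F y) = (LINT x:{0..<1}|half_line. walsh m x *\<^sub>R f x)"
  using assms unfolding is_walsh_fourier_def
proof (elim disjE conjE exE)
  let ?I = "{real m..<real m + 1}"
  assume f: "integrable half_line f" and [measurable]: "F \<in> borel_measurable half_line"
    and ae: "AE y in half_line. F y = walsh_fourier f y"
  have [measurable]: "?I \<in> sets half_line" by (simp add: atLeastLessThan_sets_half_line)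
  have "(\<lambda>y. indicator ?I y *\<^sub>R walsh_fourier f y) \<in> borel_measurable half_line"
    using set_integral_walsh_fourier(1)[OF f, of m] unfolding set_integrable_def by simp
  then have "(LINT y:?I|half_line. F y) = (LINT y:?I|half_line. walsh_fourier f y)"
    unfolding set_lebesgue_integral_def using ae by (intro integral_cong_AE) auto
  then show ?thesis by (simp add: set_integral_walsh_fourier(2)[OF f])
next
  let ?I = "{real m..<real m + 1}"
  fix u :: "nat \<Rightarrow> real \<Rightarrow> 'a"
  assume f: "f \<in> L2" and F: "F \<in> L2" and u: "\<forall>n. integrable half_line (u n) \<and> u n \<in> L2"
    and lim: "L2_tendsto u f" "L2_tendsto (\<lambda>n. walsh_fourier (u n)) F"
  interpret half_line: sigma_finite_measure half_line by (rule sigma_finite_half_line)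
  have I: "?I \<in> sets half_line" "emeasure half_line ?I = 1"
      "{0..<1::real} \<in> sets half_line" "emeasure half_line {0..<1::real} = 1"
    by (simp_all add: atLeastLessThan_sets_half_line emeasure_half_line_atLeastLessThan)
  have [measurable]: "f \<in> borel_measurable half_line" "F \<in> borel_measurable half_line"
      "\<And>n. u n \<in> borel_measurable half_line"
    using f F u by (auto simp: L2_def)
  have [measurable]: "walsh m \<in> borel_measurable half_line"
    by (rule borel_measurable_half_lineI) simp
  have swap: "(\<lambda>(y, x). walsh_kernel x y) \<in> borel_measurable (half_line \<Otimes>\<^sub>M half_line)"
    using measurable_compose[OF measurable_pair_swap' walsh_kernel_measurable] by (simp add: case_prod_unfold)
  have walsh_L2: "(\<lambda>x. walsh m x *\<^sub>R g x) \<in> L2" if "g \<in> L2" for g :: "real \<Rightarrow> 'a"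
    using that unfolding L2_def by (auto intro!: borel_measurable_scaleR)
  have 1: "(\<lambda>n. LINT y:?I|half_line. walsh_fourier (u n) y) \<longlonglongrightarrow> (LINT y:?I|half_line. F y)"
  proof (rule L2_tendsto_set_integral[OF lim(2)])
    show "walsh_fourier (u n) \<in> borel_measurable half_line" for n
      unfolding walsh_fourier_def
      by (rule half_line.borel_measurable_lebesgue_integral)
         (use swap in \<open>simp add: case_prod_unfold\<close>)
    show "set_integrable half_line ?I (walsh_fourier (u n))" for n
      using u by (simp add: set_integral_walsh_fourier(1))
    show "set_integrable half_line ?I F"
      using F I by (intro set_integrable_L2) auto
  qed (use I in auto)
  have "L2_tendsto (\<lambda>n x. walsh m x *\<^sub>R u n x) (\<lambda>x. walsh m x *\<^sub>R f x)"
    using lim(1) by (simp add: L2_tendsto_def flip: scaleR_diff_right)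
  then have 2: "(\<lambda>n. LINT x:{0..<1}|half_line. walsh m x *\<^sub>R u n x) \<longlonglongrightarrow> (LINT x:{0..<1}|half_line. walsh m x *\<^sub>R f x)"
    by (rule L2_tendsto_set_integral) (use u f I in \<open>auto intro!: set_integrable_L2 walsh_L2\<close>)
  have "(LINT y:?I|half_line. walsh_fourier (u n) y) = (LINT x:{0..<1}|half_line. walsh m x *\<^sub>R u n x)" for n
    using u by (intro set_integral_walsh_fourier(2)) simp
  with 1 have "(\<lambda>n. LINT x:{0..<1}|half_line. walsh m x *\<^sub>R u n x) \<longlonglongrightarrow> (LINT y:?I|half_line. F y)"
    by (simp only:)
  from this 2 show ?thesis by (rule LIMSEQ_unique)
qed

section \<open>A test function on the dyadic unit intervals\<close>

abbreviation dyadic_unit :: "nat \<Rightarrow> real set" where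
  "dyadic_unit k \<equiv> {2 ^ k..<2 ^ k + 1}"

text \<open>
  The interval is contained in \<open>[2\<^sup>k, 2\<^bsup>k+1\<^esup>)\<close>, so a point of it determines \<open>k\<close>. This gives both the
  disjointness of the intervals and a measurable way to recover \<open>k\<close>.
\<close>

lemma floor_log_dyadic_unit:
  assumes "x \<in> dyadic_unit k"
  shows "nat \<lfloor>log 2 x\<rfloor> = k"
proof -
  have "(1::real) \<le> 2 ^ k" by (rule one_le_power) simp
  then have x: "2 ^ k \<le> x" "x < 2 ^ Suc k" "0 < x"
    using assms unfolding power_Suc atLeastLessThan_iff by linarith+
  then have "real k \<le> log 2 x" "log 2 x < real (Suc k)"
    using x by (simp_all only: le_log_iff log_less_iff powr_realpow zero_less_numeral one_less_numeral_iff semiring_norm)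
  then have "\<lfloor>log 2 x\<rfloor> = int k" by (simp add: floor_eq_iff)
  then show ?thesis by simp
qed

lemma disjoint_family_dyadic_unit: "disjoint_family dyadic_unit"
proof -
  have "k = l" if "x \<in> dyadic_unit k" "x \<in> dyadic_unit l" for k l x
    using floor_log_dyadic_unit[OF that(1)] floor_log_dyadic_unit[OF that(2)] by (rule trans[OF sym])
  then show ?thesis unfolding disjoint_family_on_def by (meson disjoint_iff)
qed

lemma dyadic_unit_half_line: "dyadic_unit k \<in> sets half_line" "emeasure half_line (dyadic_unit k) = 1"
  by (simp_all add: atLeastLessThan_sets_half_line emeasure_half_line_atLeastLessThan)

text \<open>
  The function is \<open>2 ^ k / (Suc k * x)\<close> on the interval with index \<open>k\<close> and \<open>0\<close> elsewhere. As \<open>x \<ge> 2 ^ k\<close>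
  there, it is at most \<open>1 / Suc k\<close>, whose squares are summable. The factor \<open>2 ^ k\<close> compensates the decay
  of the means of \<open>F\<close>, and the factor \<open>1 / Suc k\<close> is square summable without being summable.
\<close>

lemma L2_function_on_dyadic_units:
  obtains g :: "real \<Rightarrow> real"
  where "(\<lambda>x. of_real (g x) :: 'a::{real_normed_field,euclidean_space}) \<in> L2"
    and "\<And>k x. x \<in> dyadic_unit k \<Longrightarrow> x * g x = 2 ^ k / real (Suc k)"
proof
  define c where "c x = nat \<lfloor>log 2 x\<rfloor>" for x :: real
  define g where "g x = indicator (\<Union>k. dyadic_unit k) x * (2 ^ c x / (real (Suc (c x)) * x))" for x :: real
  have c: "c x = k" if "x \<in> dyadic_unit k" for x k
    using that by (simp add: c_def floor_log_dyadic_unit)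
  have pos: "0 < x" if "x \<in> dyadic_unit k" for x k
    using that less_le_trans[of 0 "2 ^ k" x] by simp
  have g: "g x = 2 ^ k / (real (Suc k) * x)" if "x \<in> dyadic_unit k" for x k
    using that c[OF that] unfolding g_def by (auto simp: indicator_def)
  show "x * g x = 2 ^ k / real (Suc k)" if "x \<in> dyadic_unit k" for k x
    using g[OF that] pos[OF that] by simp
  have [measurable]: "g \<in> borel_measurable borel"
    unfolding g_def c_def by measurable
  then have meas [measurable]: "g \<in> borel_measurable half_line" by (rule borel_measurable_half_lineI)
  have bound: "ennreal ((g x)\<^sup>2) \<le> (\<Sum>k. ennreal ((inverse (real (Suc k)))\<^sup>2) * indicator (dyadic_unit k) x)" for x
  proof (cases "\<exists>k. x \<in> dyadic_unit k")
    case True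
    then obtain k where k: "x \<in> dyadic_unit k" by blast
    have "2 ^ k / x * inverse (real (Suc k)) \<le> 1 * inverse (real (Suc k))"
      using k pos[OF k] by (intro mult_right_mono) auto
    then have "g x \<le> inverse (real (Suc k))"
      by (simp only: g[OF k] mult_1) (simp add: divide_inverse mult_ac)
    moreover have "0 \<le> g x" using pos[OF k] by (simp add: g[OF k])
    ultimately have "ennreal ((g x)\<^sup>2) \<le> ennreal ((inverse (real (Suc k)))\<^sup>2)"
      by (intro ennreal_leI power_mono)
    also have "\<dots> = (\<Sum>k\<in>{k}. ennreal ((inverse (real (Suc k)))\<^sup>2) * indicator (dyadic_unit k) x)"
      using k by simp
    also have "\<dots> \<le> (\<Sum>k. ennreal ((inverse (real (Suc k)))\<^sup>2) * indicator (dyadic_unit k) x)"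
      by (rule sum_le_suminf) auto
    finally show ?thesis .
  next
    case False
    then show ?thesis by (simp add: g_def)
  qed
  have "(\<integral>\<^sup>+ x. ennreal ((g x)\<^sup>2) \<partial>half_line) \<le>
      (\<integral>\<^sup>+ x. (\<Sum>k. ennreal ((inverse (real (Suc k)))\<^sup>2) * indicator (dyadic_unit k) x) \<partial>half_line)"
    by (intro nn_integral_mono bound)
  also have "\<dots> = (\<Sum>k. ennreal ((inverse (real (Suc k)))\<^sup>2))"
    using dyadic_unit_half_line
    by (subst nn_integral_suminf) (auto simp: nn_integral_cmult_indicator)
  also have "\<dots> < \<infinity>"
  proof -
    have "summable (\<lambda>k. (inverse (real (Suc k)))\<^sup>2)"
      using inverse_power_summable[of 2, where 'a = real] by (subst summable_Suc_iff) (simp add: power_inverse)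
    then show ?thesis by (simp add: suminf_ennreal2 less_top[symmetric])
  qed
  finally have "integrable half_line (\<lambda>x. (g x)\<^sup>2)"
    by (intro integrableI_bounded) auto
  then show "(\<lambda>x. of_real (g x) :: 'a) \<in> L2"
    unfolding L2_def by (auto intro: borel_measurable_of_real)
qed

lemma summable_norm_set_integral:
  fixes h :: "'b \<Rightarrow> 'a::{banach, second_countable_topology}"
  assumes h: "integrable M h" and A: "disjoint_family A" "\<And>k. A k \<in> sets M"
  shows "summable (\<lambda>k::nat. norm (LINT x:A k|M. h x))"
proof (rule summableI_nonneg_bounded)
  have int: "set_integrable M B (\<lambda>x. norm (h x))" if "B \<in> sets M" for B
    unfolding set_integrable_def using integrable_mult_indicator[OF that integrable_norm[OF h]] .
  fix n
  have "(\<Sum>k<n. norm (LINT x:A k|M. h x)) \<le> (\<Sum>k<n. LINT x:A k|M. norm (h x))"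
  proof (rule sum_mono)
    fix k show "norm (LINT x:A k|M. h x) \<le> (LINT x:A k|M. norm (h x))"
      unfolding set_lebesgue_integral_def
      using integral_norm_bound[of M "\<lambda>x. indicator (A k) x *\<^sub>R h x"] by simp
  qed
  also have "\<dots> = (LINT x:(\<Union>k<n. A k)|M. norm (h x))"
    using A int by (subst set_integral_finite_Union) (auto intro: disjoint_family_on_mono)
  also have "\<dots> \<le> (\<integral>x. norm (h x) \<partial>M)"
    unfolding set_lebesgue_integral_def
    using A h int[of "\<Union>k<n. A k", unfolded set_integrable_def]
    by (intro integral_mono) (auto simp: indicator_def)
  finally show "(\<Sum>k<n. norm (LINT x:A k|M. h x)) \<le> (\<integral>x. norm (h x) \<partial>M)" .
qed simp

section \<open>The transform of the ramp and the contradiction\<close>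

lemma set_integral_is_walsh_fourier_ramp:
  fixes F :: "real \<Rightarrow> 'a::{real_normed_field,euclidean_space}"
  assumes "is_walsh_fourier (\<lambda>x. x *\<^sub>R indicator {0..<1} x) F"
  shows "(LINT y:dyadic_unit k|half_line. F y) = of_real (- (1 / 2 ^ (k + 2)))"
proof -
  have moment: "set_integrable half_line {0..<1} (\<lambda>x. x * walsh (2 ^ k) x)"
      "(LINT x:{0..<1}|half_line. x * walsh (2 ^ k) x) = - (1 / 2 ^ (k + 2))"
    by (rule set_integral_half_line_eqI[OF _ _ has_integral_id_times_walsh_power2, where B = 1];
        simp add: abs_mult)+
  have "(LINT y:dyadic_unit k|half_line. F y) =
      (LINT x:{0..<1}|half_line. walsh (2 ^ k) x *\<^sub>R x *\<^sub>R indicator {0..<1} x)"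
    using set_integral_is_walsh_fourier[OF assms, of "2 ^ k"] by simp
  also have "\<dots> = (\<integral>x. of_real (indicator {0..<1} x *\<^sub>R (x * walsh (2 ^ k) x)) \<partial>half_line)"
    unfolding set_lebesgue_integral_def
    by (rule Bochner_Integration.integral_cong) (auto simp: indicator_def scaleR_conv_of_real)
  also have "\<dots> = of_real (LINT x:{0..<1}|half_line. x * walsh (2 ^ k) x)"
    unfolding set_lebesgue_integral_def
    by (rule integral_bounded_linear[OF bounded_linear_of_real moment(1)[unfolded set_integrable_def]])
  also note moment(2)
  finally show ?thesis .
qed

theorem theorem1:
  shows "\<not> (\<exists>X :: (real \<Rightarrow> 'a::{real_normed_field,euclidean_space}) set.
           linear_space_of_measurable_functions X \<and>
           indicator {0..<1} \<in> X \<and>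
           walsh_fourier_invariant X \<and>
           (\<forall>f\<in>X. \<forall>a b :: real. (\<lambda>x. (a * x + b) *\<^sub>R f x) \<in> X) \<and>
           (\<forall>f\<in>X. \<forall>g\<in>L2. integrable half_line (\<lambda>x. f x * g x)))"
proof (intro notI, elim exE conjE)
  fix X :: "(real \<Rightarrow> 'a) set"
  assume ind: "indicator {0..<1} \<in> X" and four: "walsh_fourier_invariant X"
    and lin: "\<forall>f\<in>X. \<forall>a b :: real. (\<lambda>x. (a * x + b) *\<^sub>R f x) \<in> X"
    and dual: "\<forall>f\<in>X. \<forall>g\<in>L2. integrable half_line (\<lambda>x. f x * g x)"
  have ramp: "(\<lambda>x. x *\<^sub>R f x) \<in> X" if "f \<in> X" for f
    using lin[rule_format, OF that, of 1 0] by simp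
  obtain F where F: "F \<in> X" "is_walsh_fourier (\<lambda>x. x *\<^sub>R indicator {0..<1} x) F"
    using four ramp[OF ind] unfolding walsh_fourier_invariant_def by blast
  obtain g :: "real \<Rightarrow> real" where g: "(\<lambda>x. of_real (g x) :: 'a) \<in> L2"
    "\<And>k x. x \<in> dyadic_unit k \<Longrightarrow> x * g x = 2 ^ k / real (Suc k)"
    using L2_function_on_dyadic_units[where 'a = 'a] by blast
  (* The factor x before F cancels the factor 1/x in g, which leaves multiples of the means of F. *)
  define h where "h x = x *\<^sub>R F x * of_real (g x)" for x
  have "integrable half_line h"
    unfolding h_def using dual[rule_format, OF ramp[OF F(1)] g(1)] .
  then have "summable (\<lambda>k. norm (LINT x:dyadic_unit k|half_line. h x))"
    by (rule summable_norm_set_integral[OF _ disjoint_family_dyadic_unit dyadic_unit_half_line(1)])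
  moreover have "norm (LINT x:dyadic_unit k|half_line. h x) = 1 / 4 * inverse (real (Suc k))" for k
  proof -
    have "(LINT x:dyadic_unit k|half_line. h x) = (LINT x:dyadic_unit k|half_line. (2 ^ k / real (Suc k)) *\<^sub>R F x)"
    proof (rule set_lebesgue_integral_cong[OF dyadic_unit_half_line(1)], intro allI impI)
      fix x assume "x \<in> dyadic_unit k"
      have "h x = (x * g x) *\<^sub>R F x"
        by (simp add: h_def scaleR_conv_of_real mult_ac)
      then show "h x = (2 ^ k / real (Suc k)) *\<^sub>R F x"
        by (simp only: g(2)[OF \<open>x \<in> dyadic_unit k\<close>])
    qed
    also have "\<dots> = (2 ^ k / real (Suc k)) *\<^sub>R of_real (- (1 / 2 ^ (k + 2)))"
      using set_integral_is_walsh_fourier_ramp[OF F(2)] by simp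
    also have "norm \<dots> = 1 / 4 * inverse (real (Suc k))"
      unfolding norm_scaleR norm_of_real by (simp add: power_add field_simps del: of_nat_Suc)
    finally show ?thesis .
  qed
  ultimately have "summable (\<lambda>k. 1 / 4 * inverse (real (Suc k)))" by simp
  then have "summable (\<lambda>k. inverse (real (Suc k)))"
    by (subst (asm) summable_cmult_iff) simp
  then show False
    using not_summable_harmonic[where 'a = real] summable_Suc_iff[of "\<lambda>k. inverse (real k)"] by simp
qed

end
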